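(* Let $a$ be an integer and $v\in\mathbb{C}$. For all $n\in\mathbb{N}_0$, $${}_H\beta_n^{(a)}(x+1,v)=n\,{}_H\beta_{n-1}^{(a-1)}(x,v)+{}_H\beta_n^{(a)}(x,v),$$ where for $n=0$ the first term on the right is read as $0$.
   Context: $\mathbb{N}_0=\{0,1,2,\dots\}$. For an integer $a$ and $v\in\mathbb{C}$ the polynomials ${}_H\beta_n^{(a)}(x,v)$ in $x$ are defined by the formal power series identity $$\left(\frac{t}{e^t-1}\right)^a e^{xt-\frac{v t^2}{2}}=\sum_{n=0}^\infty {}_H\beta_n^{(a)}(x,v)\frac{t^n}{n!}.$$ *)

theory Defs
  imports Complex_Main "HOL-Computational_Algebra.Computational_Algebra"
begin

unbundle fps_syntax

(* The generating function lives in C[x][[t]]: coefficients are polynomials in x,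
   the series variable t is fps_X. *)

definition lift_const :: "complex fps \<Rightarrow> complex poly fps" where
  "lift_const F = Abs_fps (\<lambda>n. [:F $ n:])"

(* The base t / (e^t - 1) is a unit of C[[t]] (constant term 1), so powi is the
   integer power there, negative exponents included.  The last factor is
   e^(x t - v t^2 / 2); [:0, 1:] is the polynomial variable x. *)

definition hermite_bernoulli_gf :: "int \<Rightarrow> complex \<Rightarrow> complex poly fps" where
  "hermite_bernoulli_gf a v =
     lift_const ((fps_X / (fps_exp 1 - 1)) powi a) *
     (lift_const (fps_exp 1) oo
        (fps_const [:0, 1:] * fps_X - fps_const [:v / 2:] * fps_X ^ 2))"

definition hermite_bernoulli :: "int \<Rightarrow> nat \<Rightarrow> complex \<Rightarrow> complex poly" where
  "hermite_bernoulli a n v = smult (fact n) (hermite_bernoulli_gf a v $ n)"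

(* Sanity checks: the base of the integer power is the expected unit, and
   specialising x to a complex number gives the defining identity in C[[t]]. *)

lemma bernoulli_base:
  shows "(fps_X / (fps_exp 1 - 1)) * (fps_exp 1 - 1) = (fps_X :: complex fps)"
    and "(fps_X / (fps_exp 1 - 1) :: complex fps) $ 0 = 1"
proof -
  let ?E = "fps_exp 1 - 1 :: complex fps"
  have sd: "subdegree ?E = 1"
    by (rule subdegreeI) auto
  have nz: "?E \<noteq> 0" using sd by auto
  have "?E dvd fps_X"
    using nz sd by (subst fps_dvd_iff) auto
  then show eq: "(fps_X / ?E) * ?E = fps_X" by simp
  have "((fps_X / ?E) * ?E) $ 1 = 1" using eq by simp
  then show "(fps_X / ?E) $ 0 = 1"
    by (simp add: fps_mult_nth)
qed

lemma hermite_bernoulli_at: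
  "Abs_fps (\<lambda>n. poly (hermite_bernoulli a n v) x / fact n) =
     (fps_X / (fps_exp 1 - 1)) powi a *
     (fps_exp 1 oo (fps_const x * fps_X - fps_const (v / 2) * fps_X ^ 2))"
proof -
  define ev :: "complex poly fps \<Rightarrow> complex fps" where
    "ev F = Abs_fps (\<lambda>n. poly (F $ n) x)" for F
  have ev_nth: "ev F $ n = poly (F $ n) x" for F n by (simp add: ev_def)
  have ev_mult: "ev (F * G) = ev F * ev G" for F G
    by (simp add: fps_eq_iff ev_nth fps_mult_nth poly_sum)
  have ev_one: "ev 1 = 1"
    by (simp add: fps_eq_iff ev_nth)
  have ev_diff: "ev (F - G) = ev F - ev G" for F G
    by (simp add: fps_eq_iff ev_nth)
  have ev_pow: "ev (F ^ k) = ev F ^ k" for F k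
    by (induction k) (simp_all add: ev_mult ev_one)
  have ev_const: "ev (fps_const c) = fps_const (poly c x)" for c
    by (simp add: fps_eq_iff ev_nth)
  have ev_X: "ev fps_X = fps_X"
    by (simp add: fps_eq_iff ev_nth fps_X_def)
  have ev_lift: "ev (lift_const F) = F" for F
    by (simp add: fps_eq_iff ev_nth lift_const_def)
  have ev_comp: "ev (F oo G) = ev F oo ev G" for F G
    by (simp add: fps_eq_iff ev_nth fps_compose_nth poly_sum flip: ev_pow)
  have "Abs_fps (\<lambda>n. poly (hermite_bernoulli a n v) x / fact n) =
      ev (hermite_bernoulli_gf a v)"
    by (simp add: fps_eq_iff ev_nth hermite_bernoulli_def)
  then show ?thesis
    by (simp add: hermite_bernoulli_gf_def ev_mult ev_comp ev_lift ev_diff ev_const ev_X ev_pow)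
qed

end

(* Multiplying the generating function at x by e^t shifts x to x + 1. Hence the difference of the
   generating functions at x + 1 and x is the one at x times e^t - 1, and this factor turns
   (t / (e^t - 1))^a into t (t / (e^t - 1))^(a - 1). *)

theory Submission
  imports Defs
begin

text \<open>The quotient \<open>F * inverse G\<close> has derivative 0, so it is constant, and its
  constant term is 1.\<close>

lemma fps_linear_ode_unique:
  fixes F G R :: "'a :: field_char_0 fps"
  assumes "fps_deriv F = F * R" "fps_deriv G = G * R" "F $ 0 = G $ 0" "G $ 0 \<noteq> 0"
  shows "F = G"
proof -
  have inv: "G * inverse G = 1"
    using assms(4) by (simp add: inverse_mult_eq_1')
  \<comment> \<open>The factor \<open>G * inverse G\<close> is kept grouped so that
    \<open>inv\<close> can rewrite it to 1.\<close>
  have "fps_deriv (F * inverse G) = F * R * inverse G - F * (inverse G * (G * inverse G)) * R"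
    using assms(1,2,4) by (simp add: fps_inverse_deriv power2_eq_square algebra_simps)
  also have "\<dots> = 0"
    unfolding inv by (simp add: algebra_simps)
  finally have "F * inverse G = fps_const ((F * inverse G) $ 0)"
    by (simp only: fps_deriv_eq_0_iff)
  also have "\<dots> = 1"
    using assms(3,4) by simp
  finally have "F * inverse G = 1" .
  then have "F * (G * inverse G) = G"
    by (simp add: algebra_simps)
  then show ?thesis
    by (simp add: inv)
qed

text \<open>Both sides have constant term 1 and solve Y' = Y (P' + 1); the chain rule uses
  \<open>P $ 0 = 0\<close>.\<close>

lemma fps_exp_compose_add_X:
  fixes P :: "'a :: field_char_0 fps"
  assumes "P $ 0 = 0"
  shows "fps_exp 1 oo (P + fps_X) = fps_exp 1 * (fps_exp 1 oo P)"
proof (rule fps_linear_ode_unique)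
  show "fps_deriv (fps_exp 1 oo (P + fps_X)) = (fps_exp 1 oo (P + fps_X)) * (fps_deriv P + 1)"
    using assms by (simp add: fps_compose_deriv)
  show "fps_deriv (fps_exp 1 * (fps_exp 1 oo P)) = fps_exp 1 * (fps_exp 1 oo P) * (fps_deriv P + 1)"
    using assms by (simp add: fps_compose_deriv algebra_simps)
qed simp_all

text \<open>Power series do not form a field: \<open>inverse B\<close> cancels \<open>B\<close>
  because the constant term is nonzero.\<close>

lemma fps_power_int_minus_mult:
  fixes B :: "'a :: field fps"
  assumes "B $ 0 \<noteq> 0"
  shows "B powi (a - 1) * B = B powi a"
proof (cases "a \<ge> 1")
  case True
  then have "nat a = Suc (nat (a - 1))"
    by simp
  with True show ?thesis
    by (simp add: power_int_def)
next
  case False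
  then have exponent: "nat (1 - a) = Suc (nat (- a))"
    by simp
  have "B powi (a - 1) * B = inverse B ^ nat (- a) * (inverse B * B)"
    using False exponent by (simp add: power_int_def algebra_simps)
  also have "\<dots> = B powi a"
    \<comment> \<open>At \<open>a = 0\<close> the right side is an ordinary power, although
      \<open>a - 1\<close> is already negative.\<close>
    using False assms by (cases "a = 0") (simp_all add: power_int_def inverse_mult_eq_1)
  finally show ?thesis .
qed

theorem theorem4:
  fixes a :: int and v x :: complex and n :: nat
  shows "poly (hermite_bernoulli a n v) (x + 1) =
           (if n = 0 then 0
            else of_nat n * poly (hermite_bernoulli (a - 1) (n - 1) v) x)
           + poly (hermite_bernoulli a n v) x"
proof -
  \<comment> \<open>Evaluating at a number \<open>y\<close> gives series over a field, as the lemmas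
    above require.\<close>
  define gf :: "int \<Rightarrow> complex \<Rightarrow> complex fps"
    where "gf b y = Abs_fps (\<lambda>n. poly (hermite_bernoulli b n v) y / fact n)" for b y
  define B :: "complex fps" where "B = fps_X / (fps_exp 1 - 1)"
  define P where "P = fps_const x * fps_X - fps_const (v / 2) * fps_X ^ 2"
  have gf_x: "gf b x = B powi b * (fps_exp 1 oo P)" for b
    by (simp add: gf_def B_def P_def hermite_bernoulli_at)
  \<comment> \<open>Only the linear term of the exponent contains \<open>x\<close>, so the shift
    adds exactly t.\<close>
  have "fps_const (x + 1) * fps_X - fps_const (v / 2) * fps_X ^ 2 = P + fps_X"
    by (simp add: P_def algebra_simps flip: fps_const_add)
  then have "gf a (x + 1) = B powi a * (fps_exp 1 oo (P + fps_X))"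
    unfolding gf_def B_def hermite_bernoulli_at by simp
  also have "\<dots> = B powi a * (fps_exp 1 * (fps_exp 1 oo P))"
    by (subst fps_exp_compose_add_X) (simp_all add: P_def)
  \<comment> \<open>Split e^t as (e^t - 1) + 1; the summand 1 yields \<open>gf a x\<close>.\<close>
  also have "\<dots> = B powi a * (fps_exp 1 - 1) * (fps_exp 1 oo P) + gf a x"
    by (simp add: gf_x algebra_simps)
  also have "B powi a * (fps_exp 1 - 1) = B powi (a - 1) * (B * (fps_exp 1 - 1))"
    using fps_power_int_minus_mult[of B a] bernoulli_base(2) by (simp add: B_def mult.assoc)
  also have "B * (fps_exp 1 - 1) = fps_X"
    using bernoulli_base(1) by (simp add: B_def)
  also have "B powi (a - 1) * fps_X * (fps_exp 1 oo P) = fps_X * gf (a - 1) x"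
    by (simp add: gf_x algebra_simps)
  finally have "gf a (x + 1) $ n = (fps_X * gf (a - 1) x + gf a x) $ n"
    by simp
  \<comment> \<open>The factor \<open>fps_X\<close> shifts the index, giving 0 at
    \<open>n = 0\<close> and the denominator (n - 1)! otherwise.\<close>
  then have coeff: "poly (hermite_bernoulli a n v) (x + 1) / fact n =
      (if n = 0 then 0 else poly (hermite_bernoulli (a - 1) (n - 1) v) x / fact (n - 1))
      + poly (hermite_bernoulli a n v) x / fact n"
    by (simp add: gf_def)
  have fact_div: "0 < n \<Longrightarrow> fact n / fact (n - Suc 0) = (of_nat n :: complex)"
    by (simp add: fact_reduce)
  \<comment> \<open>Multiplying by n! clears the denominators; n! / (n - 1)! is the factor n of the
    claim.\<close>
  from arg_cong[OF coeff, of "\<lambda>c. fact n * c"] show ?thesis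
    by (simp add: distrib_left fact_div flip: times_divide_eq_left split: if_splits)
qed

end
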